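(* Let $\sigma>0$ and let $(\psi,\vartheta)$ be a $\sigma$-periodic cocycle in a real separable Hilbert space $\mathbb{H}$. Suppose: (i) $P\colon\mathbb{H}\to\mathbb{H}$ is a bounded self-adjoint linear operator and $\mathbb{H}=\mathbb{H}^{+}\oplus\mathbb{H}^{-}$ is an orthogonal direct sum of $P$-invariant subspaces with $P|_{\mathbb{H}^{-}}<0$ and $P|_{\mathbb{H}^{+}}>0$; (ii) $\dim\mathbb{H}^{-}=1$; (iii) with $V(u):=(Pu,u)$ there are numbers $\delta>0$ and $\nu>0$ such that $$e^{2\nu r}V(\psi^{r}(q,u)-\psi^{r}(q,v))-e^{2\nu l}V(\psi^{l}(q,u)-\psi^{l}(q,v))\le-\delta\int_{l}^{r}e^{2\nu s}|\psi^{s}(q,u)-\psi^{s}(q,v)|^{2}ds$$ for all $u,v\in\mathbb{H}$, $q\in\mathcal{Q}$ and $0\le l\le r$; (iv) every bounded semi-trajectory of the cocycle is compact. Then for every bounded semi-trajectory $u(t):=\psi^{t}(q,u_0)$, $t\ge0$ (with $q\in\mathcal{Q}$, $u_0\in\mathbb{H}$), there exists a $\sigma$-periodic trajectory $u^{*}$ at $q$ such that $u(t)-u^{*}(t)\to0$ as $t\to+\infty$.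
   Context: A cocycle $(\psi,\vartheta)$ in $\mathbb{H}$ over a flow $\{\vartheta^t\}_{t\in\mathbb{R}}$ on a metric space $\mathcal{Q}$ is a family of maps $\psi^{t}\colon\mathcal{Q}\times\mathbb{H}\to\mathbb{H}$, $t\ge0$, such that $\psi^{0}(q,u)=u$; $\psi^{t+s}(q,u)=\psi^{t}(\vartheta^{s}(q),\psi^{s}(q,u))$ for all $u,q$ and $t,s\ge0$; and $(t,q,u)\mapsto\psi^{t}(q,u)$ is continuous on $\mathbb{R}_{+}\times\mathcal{Q}\times\mathbb{H}$. It is $\sigma$-periodic if $\mathcal{Q}=\mathbb{R}/\sigma\mathbb{Z}$ and $\vartheta^{t}(\theta)=\theta+t$. $P|_{E}<0$ (resp. $>0$) means $(Pu,u)<0$ (resp. $>0$) for all non-zero $u\in E$. A semi-trajectory is a map $t\mapsto\psi^t(q,u_0)$, $t\ge 0$; it is bounded (resp. compact) if its range is bounded (resp. relatively compact) in $\mathbb{H}$. A complete trajectory at $q$ is a continuous map $u\colon\mathbb{R}\to\mathbb{H}$ with $u(t+s)=\psi^{t}(\vartheta^{s}(q),u(s))$ for all $t\ge0$, $s\in\mathbb{R}$. A $\sigma$-periodic trajectory at $q$ is a complete trajectory $u^*$ at $q$ with $u^{*}(t+\sigma)=u^{*}(t)$ for all $t$. *)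

theory Defs
  imports "HOL-Analysis.Analysis"
begin

locale metric_flow = Metric_space Q d
  for Q :: "'q set" and d :: "'q \<Rightarrow> 'q \<Rightarrow> real" +
  fixes \<theta> :: "real \<Rightarrow> 'q \<Rightarrow> 'q"
  assumes flow_zero: "q \<in> Q \<Longrightarrow> \<theta> 0 q = q"
    and flow_add: "q \<in> Q \<Longrightarrow> \<theta> (t + s) q = \<theta> t (\<theta> s q)"
    and flow_continuous:
      "continuous_map (prod_topology euclideanreal mtopology) mtopology (\<lambda>(t, q). \<theta> t q)"

text \<open>Only the values of \<psi> at times \<open>t \<ge> 0\<close> and base points in \<open>Q\<close> are meaningful.\<close>

locale cocycle = metric_flow Q d \<theta>
  for Q :: "'q set" and d :: "'q \<Rightarrow> 'q \<Rightarrow> real" and \<theta> :: "real \<Rightarrow> 'q \<Rightarrow> 'q" +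
  fixes \<psi> :: "real \<Rightarrow> 'q \<Rightarrow> 'h::real_inner \<Rightarrow> 'h"
  assumes cocycle_zero: "q \<in> Q \<Longrightarrow> \<psi> 0 q u = u"
    and cocycle_add:
      "\<lbrakk>q \<in> Q; 0 \<le> t; 0 \<le> s\<rbrakk> \<Longrightarrow> \<psi> (t + s) q u = \<psi> t (\<theta> s q) (\<psi> s q u)"
    and cocycle_continuous:
      "continuous_map
         (prod_topology (top_of_set {0..}) (prod_topology mtopology euclidean)) euclidean
         (\<lambda>(t, q, u). \<psi> t q u)"

text \<open>The circle \<open>\<real> / \<sigma>\<int>\<close> is the set of cosets \<open>x + \<sigma>\<int>\<close>, with the quotient metric
  \<^const>\<open>setdist\<close> (the infimum of the distances between representatives).\<close>

definition circle_coset :: "real \<Rightarrow> real \<Rightarrow> real set" where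
  "circle_coset \<sigma> x = range (\<lambda>k::int. x + of_int k * \<sigma>)"

definition circle :: "real \<Rightarrow> real set set" where
  "circle \<sigma> = range (circle_coset \<sigma>)"

definition rotation :: "real \<Rightarrow> real set \<Rightarrow> real set" where
  "rotation t A = (\<lambda>x. x + t) ` A"

definition periodic_cocycle ::
    "real \<Rightarrow> (real \<Rightarrow> real set \<Rightarrow> 'h::real_inner \<Rightarrow> 'h) \<Rightarrow> bool" where
  "periodic_cocycle \<sigma> \<psi> \<longleftrightarrow> cocycle (circle \<sigma>) setdist rotation \<psi>"

definition complete_trajectory ::
    "(real \<Rightarrow> 'q \<Rightarrow> 'q) \<Rightarrow> (real \<Rightarrow> 'q \<Rightarrow> 'h::real_inner \<Rightarrow> 'h) \<Rightarrow> 'q \<Rightarrow> (real \<Rightarrow> 'h) \<Rightarrow> bool" where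
  "complete_trajectory \<theta> \<psi> q u \<longleftrightarrow>
     continuous_on UNIV u \<and> (\<forall>t\<ge>0. \<forall>s. u (t + s) = \<psi> t (\<theta> s q) (u s))"

definition periodic_trajectory ::
    "real \<Rightarrow> (real \<Rightarrow> real set \<Rightarrow> 'h::real_inner \<Rightarrow> 'h) \<Rightarrow> real set \<Rightarrow> (real \<Rightarrow> 'h) \<Rightarrow> bool" where
  "periodic_trajectory \<sigma> \<psi> q u \<longleftrightarrow>
     complete_trajectory rotation \<psi> q u \<and> (\<forall>t. u (t + \<sigma>) = u t)"

definition bounded_semi_trajectory :: "(real \<Rightarrow> 'h::real_inner) \<Rightarrow> bool" where
  "bounded_semi_trajectory u \<longleftrightarrow> bounded (u ` {0..})"

definition compact_semi_trajectory :: "(real \<Rightarrow> 'h::real_inner) \<Rightarrow> bool" where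
  "compact_semi_trajectory u \<longleftrightarrow> compact (closure (u ` {0..}))"

definition self_adjoint :: "('h::real_inner \<Rightarrow> 'h) \<Rightarrow> bool" where
  "self_adjoint P \<longleftrightarrow> (\<forall>u v. P u \<bullet> v = u \<bullet> P v)"

definition negative_on :: "('h::real_inner \<Rightarrow> 'h) \<Rightarrow> 'h set \<Rightarrow> bool" where
  "negative_on P E \<longleftrightarrow> (\<forall>u\<in>E. u \<noteq> 0 \<longrightarrow> P u \<bullet> u < 0)"

definition positive_on :: "('h::real_inner \<Rightarrow> 'h) \<Rightarrow> 'h set \<Rightarrow> bool" where
  "positive_on P E \<longleftrightarrow> (\<forall>u\<in>E. u \<noteq> 0 \<longrightarrow> P u \<bullet> u > 0)"

text \<open>Directness and closedness of the two subspaces follow from orthogonality together with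
  their sum being the whole space.\<close>

definition orthogonal_direct_sum :: "'h::real_inner set \<Rightarrow> 'h set \<Rightarrow> bool" where
  "orthogonal_direct_sum A B \<longleftrightarrow>
     subspace A \<and> subspace B \<and> (\<forall>a\<in>A. \<forall>b\<in>B. orthogonal a b) \<and> (\<forall>u. \<exists>a\<in>A. \<exists>b\<in>B. u = a + b)"

text \<open>The circle with its rotations is an instance of \<^locale>\<open>metric_flow\<close>.\<close>

lemma mem_circle_shift:
  assumes "C \<in> circle \<sigma>" "b \<in> B" "b' \<in> B" "B \<in> circle \<sigma>" "c \<in> C"
  shows "c + (b - b') \<in> C"
proof -
  obtain x y where C: "C = circle_coset \<sigma> x" and B: "B = circle_coset \<sigma> y"
    using assms by (auto simp: circle_def)
  obtain i j k :: int where "c = x + of_int i * \<sigma>" "b = y + of_int j * \<sigma>" "b' = y + of_int k * \<sigma>"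
    using assms unfolding C B circle_coset_def by blast
  then have "c + (b - b') = x + of_int (i + j - k) * \<sigma>"
    by (simp add: algebra_simps)
  then show ?thesis
    unfolding C circle_coset_def by blast
qed

lemma circle_nonempty: "A \<in> circle \<sigma> \<Longrightarrow> A \<noteq> {}"
  by (auto simp: circle_def circle_coset_def)

lemma circle_setdist_ltE:
  assumes "A \<in> circle \<sigma>" "B \<in> circle \<sigma>" "setdist A B < e"
  obtains a b where "a \<in> A" "b \<in> B" "\<bar>a - b\<bar> < e"
  using setdist_ltE[OF assms(3)] circle_nonempty assms by (metis dist_real_def)

lemma circle_closed:
  assumes "\<sigma> > 0" "A \<in> circle \<sigma>"
  shows "closed A"
proof -
  obtain x where A: "A = circle_coset \<sigma> x"
    using assms by (auto simp: circle_def)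
  have "A = (\<lambda>y. x + \<sigma> * y) ` \<int>"
    unfolding A circle_coset_def Ints_def by (auto simp: mult.commute)
  moreover have "closed ((+) x ` ((*\<^sub>R) \<sigma> ` \<int>))"
    by (intro closed_translation closed_scaling) (auto intro: closed_Ints)
  ultimately show ?thesis
    by (simp add: image_image)
qed

lemma circle_eqI:
  assumes "A \<in> circle \<sigma>" "B \<in> circle \<sigma>" "a \<in> A" "a \<in> B"
  shows "A = B"
proof
  show "A \<subseteq> B"
  proof
    fix z assume "z \<in> A"
    with mem_circle_shift[of B \<sigma> z A a a] assms show "z \<in> B" by simp
  qed
  show "B \<subseteq> A"
  proof
    fix z assume "z \<in> B"
    with mem_circle_shift[of A \<sigma> z B a a] assms show "z \<in> A" by simp
  qed
qed

lemma Metric_space_circle: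
  assumes "\<sigma> > 0"
  shows "Metric_space (circle \<sigma>) setdist"
proof
  fix A B C :: "real set"
  show "0 \<le> setdist A B" "setdist A B = setdist B A"
    by (simp_all add: setdist_sym)
  assume A: "A \<in> circle \<sigma>" and B: "B \<in> circle \<sigma>"
  show "setdist A B = 0 \<longleftrightarrow> A = B"
  proof
    assume 0: "setdist A B = 0"
    obtain a where a: "a \<in> A" using circle_nonempty[OF A] by blast
    have "infdist a B < e" if "e > 0" for e
    proof -
      obtain a' b where "a' \<in> A" "b \<in> B" "\<bar>a' - b\<bar> < e"
        using circle_setdist_ltE[OF A B] 0 \<open>e > 0\<close> by metis
      then have "b + (a - a') \<in> B" "dist a (b + (a - a')) < e"
        using mem_circle_shift[OF B a _ A] by (auto simp: dist_real_def)
      then show ?thesis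
        by (meson infdist_le order_le_less_trans)
    qed
    then have "infdist a B = 0"
      by (metis infdist_nonneg less_irrefl order_le_less)
    then have "a \<in> B"
      using in_closed_iff_infdist_zero[OF circle_closed[OF assms B] circle_nonempty[OF B]] by simp
    with a show "A = B" using circle_eqI[OF A B] by blast
  qed (simp add: setdist_refl)
  assume C: "C \<in> circle \<sigma>"
  show "setdist A C \<le> setdist A B + setdist B C"
  proof (rule field_le_epsilon)
    fix e :: real assume "e > 0"
    then obtain a b where ab: "a \<in> A" "b \<in> B" "\<bar>a - b\<bar> < setdist A B + e / 2"
      using circle_setdist_ltE[OF A B, of "setdist A B + e / 2"] by auto
    obtain b' c where bc: "b' \<in> B" "c \<in> C" "\<bar>b' - c\<bar> < setdist B C + e / 2"
      using circle_setdist_ltE[OF B C, of "setdist B C + e / 2"] \<open>e > 0\<close> by auto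
    have "c + (b - b') \<in> C"
      using mem_circle_shift[OF C ab(2) bc(1) B bc(2)] .
    then have "setdist A C \<le> dist a (c + (b - b'))"
      using ab(1) setdist_le_dist by blast
    also have "\<dots> \<le> \<bar>a - b\<bar> + \<bar>b' - c\<bar>"
      by (simp add: dist_real_def)
    finally show "setdist A C \<le> setdist A B + setdist B C + e"
      using ab bc by simp
  qed
qed

lemma rotation_in_circle: "A \<in> circle \<sigma> \<Longrightarrow> rotation t A \<in> circle \<sigma>"
proof -
  assume "A \<in> circle \<sigma>"
  then obtain x where "A = circle_coset \<sigma> x" by (auto simp: circle_def)
  then have "rotation t A = circle_coset \<sigma> (x + t)"
    by (auto simp: rotation_def circle_coset_def image_image algebra_simps)
  then show ?thesis by (simp add: circle_def)
qed

lemma setdist_rotation_le: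
  assumes A: "A \<in> circle \<sigma>" and B: "B \<in> circle \<sigma>"
  shows "setdist (rotation t A) (rotation s B) \<le> \<bar>t - s\<bar> + setdist A B"
proof (rule field_le_epsilon)
  fix e :: real assume "e > 0"
  then obtain a b where ab: "a \<in> A" "b \<in> B" "\<bar>a - b\<bar> < setdist A B + e"
    using circle_setdist_ltE[OF A B, of "setdist A B + e"] by auto
  then have "setdist (rotation t A) (rotation s B) \<le> dist (a + t) (b + s)"
    by (intro setdist_le_dist) (auto simp: rotation_def)
  also have "\<dots> \<le> \<bar>t - s\<bar> + \<bar>a - b\<bar>"
    by (simp add: dist_real_def)
  finally show "setdist (rotation t A) (rotation s B) \<le> \<bar>t - s\<bar> + setdist A B + e"
    using ab by simp
qed

lemma metric_flow_circle:
  assumes "\<sigma> > 0"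
  shows "metric_flow (circle \<sigma>) setdist rotation"
proof -
  interpret Metric_space "circle \<sigma>" setdist
    using Metric_space_circle[OF assms] .
  show ?thesis
  proof
    show "rotation 0 q = q" for q
      by (simp add: rotation_def)
    show "rotation (t + s) q = rotation t (rotation s q)" for q t s
      by (simp add: rotation_def image_image add_ac)
    show "continuous_map (prod_topology euclideanreal mtopology) mtopology (\<lambda>(t, q). rotation t q)"
      unfolding continuous_map_to_metric
    proof (intro ballI allI impI)
      fix z :: "real \<times> real set" and e :: real
      assume z: "z \<in> topspace (prod_topology euclideanreal mtopology)" and "e > 0"
      obtain t A where zA: "z = (t, A)" and A: "A \<in> circle \<sigma>"
        using z by auto
      let ?U = "ball t (e / 2) \<times> mball A (e / 2)"
      have "openin (prod_topology euclideanreal mtopology) ?U"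
        by (simp add: openin_prod_Times_iff)
      moreover have "z \<in> ?U"
        using A \<open>e > 0\<close> by (simp add: zA setdist_refl)
      moreover have "(case y of (t, q) \<Rightarrow> rotation t q) \<in> mball (case z of (t, q) \<Rightarrow> rotation t q) e"
        if "y \<in> ?U" for y
      proof -
        obtain s B where y: "y = (s, B)" by fastforce
        with that have B: "B \<in> circle \<sigma>" "\<bar>t - s\<bar> < e / 2" "setdist A B < e / 2"
          by (auto simp: dist_real_def)
        then have "setdist (rotation t A) (rotation s B) < e"
          using setdist_rotation_le[OF A B(1), of t s] by simp
        then show ?thesis
          using A B by (simp add: y zA rotation_in_circle)
      qed
      ultimately show "\<exists>U. openin (prod_topology euclideanreal mtopology) U \<and> z \<in> U \<and>
          (\<forall>y\<in>U. (case y of (t, q) \<Rightarrow> rotation t q) \<in> mball (case z of (t, q) \<Rightarrow> rotation t q) e)"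
        by blast
    qed
  qed
qed

end

theory Submission
  imports Defs
begin

text \<open>
  Write \<open>u\<^sub>n = u (n\<sigma>)\<close> and \<open>w t = u (t + \<sigma>) - u t\<close>. It suffices that \<open>u\<^sub>n\<close> converges: its limit is then a
  fixed point of the period map, and the trajectory through it is periodic and attracts \<open>u\<close>.
  Since \<open>exp (2\<nu>t) V (w t)\<close> is nonincreasing, there are two cases.

  If \<open>V (w t) \<ge> 0\<close> for all \<open>t\<close>, then \<open>exp (2\<nu>t) |w t|\<^sup>2\<close> is integrable. By the mean value theorem
  and compactness of \<open>[0, \<sigma>]\<close>, some phase \<open>s\<close> satisfies \<open>|w (s + n\<sigma>)| \<le> C exp (-\<nu>n\<sigma>)\<close> for all \<open>n\<close>,
  so \<open>u (s + n\<sigma>)\<close> is a Cauchy sequence, and the cocycle carries its limit from \<open>s\<close> to \<open>\<sigma>\<close>.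

  If \<open>V (w t)\<close> is eventually negative, then \<open>w t\<close> eventually avoids \<open>H\<^sup>+\<close>; as \<open>H\<^sup>-\<close> is a line spanned
  by some \<open>e\<close>, the inner product \<open>w t \<bullet> e\<close> has constant sign and \<open>u\<^sub>n \<bullet> e\<close> converges by monotonicity.
  Moreover \<open>V (u\<^sub>m - u\<^sub>n) \<le> M exp (-2\<nu>\<sigma> min m n)\<close>, so any two limit points \<open>x\<close>, \<open>y\<close> of \<open>u\<^sub>n\<close> satisfy
  \<open>x - y \<in> H\<^sup>+\<close> and \<open>V (x - y) \<le> 0\<close>, hence coincide.
\<close>

section \<open>Preliminaries on sequences and integrals\<close>

text \<open>If the sequence did not tend to one of its limit points \<open>x\<close>, infinitely
  many terms would keep a distance \<open>e\<close> from \<open>x\<close>. Compactness extracts a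
  limit from these terms as well, and uniqueness makes it \<open>x\<close>, a contradiction.\<close>

lemma convergent_if_unique_subseq_limit:
  fixes X :: "nat \<Rightarrow> 'a::metric_space"
  assumes "compact C" and "\<And>n. X n \<in> C"
    and unique: "\<And>r r' x y. \<lbrakk>strict_mono (r :: nat \<Rightarrow> nat); strict_mono (r' :: nat \<Rightarrow> nat);
          (X \<circ> r) \<longlonglongrightarrow> x; (X \<circ> r') \<longlonglongrightarrow> y\<rbrakk> \<Longrightarrow> x = y"
  shows "convergent X"
proof -
  have seq: "seq_compact C"
    using assms(1) by (simp add: compact_eq_seq_compact_metric)
  obtain x r where r: "strict_mono (r :: nat \<Rightarrow> nat)" "(X \<circ> r) \<longlonglongrightarrow> x"
    using seq_compactE[OF seq, of X] assms(2) by blast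
  have "X \<longlonglongrightarrow> x"
  proof (rule ccontr)
    assume "\<not> X \<longlonglongrightarrow> x"
    then obtain e where e: "e > 0" "\<And>N. \<exists>n\<ge>N. e \<le> dist (X n) x"
      unfolding lim_sequentially by (meson not_less)
    have "infinite {n. e \<le> dist (X n) x}"
      unfolding infinite_nat_iff_unbounded_le using e(2) by blast
    then obtain s where s: "strict_mono (s :: nat \<Rightarrow> nat)" "\<And>n. e \<le> dist (X (s n)) x"
      using infinite_enumerate by (metis (mono_tags, lifting) mem_Collect_eq)
    obtain y k where k: "strict_mono (k :: nat \<Rightarrow> nat)" "((X \<circ> s) \<circ> k) \<longlonglongrightarrow> y"
      using seq_compactE[OF seq, of "X \<circ> s"] assms(2) by (metis comp_apply)
    have "y = x"
      using unique[of "s \<circ> k" r y x] s k r by (simp add: strict_mono_o o_assoc)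
    then have "\<forall>\<^sub>F n in sequentially. dist (X (s (k n))) x < e"
      using k(2) e(1) by (auto simp: tendsto_iff)
    then show False
      using s(2) by (auto simp: not_less[symmetric] eventually_sequentially)
  qed
  then show ?thesis by (rule convergentI)
qed

lemma Cauchy_if_summable_dist:
  fixes X :: "nat \<Rightarrow> 'a::metric_space"
  assumes "summable (\<lambda>n. dist (X n) (X (Suc n)))"
  shows "Cauchy X"
proof (rule metric_CauchyI)
  fix e :: real assume "e > 0"
  then obtain N where N: "\<And>m n. m \<ge> N \<Longrightarrow> norm (\<Sum>k=m..<n. dist (X k) (X (Suc k))) < e"
    using assms unfolding summable_Cauchy by blast
  have le: "dist (X m) (X n) \<le> (\<Sum>k=m..<n. dist (X k) (X (Suc k)))" if "m \<le> n" for m n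
    using that
  proof (induction n rule: dec_induct)
    case (step n)
    then show ?case
      using dist_triangle[of "X m" "X (Suc n)" "X n"] by simp
  qed simp
  have "dist (X m) (X n) < e" if "N \<le> m" "m \<le> n" for m n
    using le[OF that(2)] N[OF that(1), of n] by simp
  then have "dist (X m) (X n) < e" if "N \<le> m" "N \<le> n" for m n
    using that by (metis dist_commute linear)
  then show "\<exists>M. \<forall>m\<ge>M. \<forall>n\<ge>M. dist (X m) (X n) < e" by blast
qed

text \<open>Folds a long time interval onto one period, so that a bound on the integral becomes a
  bound on the average over phases.\<close>

lemma integral_shift_period_sum:
  fixes f :: "real \<Rightarrow> real"
  assumes "continuous_on {0..} f" "\<sigma> \<ge> 0"
  shows "integral {0..\<sigma>} (\<lambda>s. \<Sum>n<N. f (s + real n * \<sigma>)) = integral {0..real N * \<sigma>} f"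
proof -
  have integ: "f integrable_on {a..b}" if "0 \<le> a" for a b
    by (rule integrable_continuous_real) (rule continuous_on_subset[OF assms(1)], use that in auto)
  have cont: "continuous_on {0..\<sigma>} (\<lambda>s. f (s + real n * \<sigma>))" for n
    by (rule continuous_on_compose2[OF assms(1)]) (auto intro!: continuous_intros simp: assms(2))
  show ?thesis
  proof (induction N)
    case (Suc N)
    have "integral {0..\<sigma>} (\<lambda>s. \<Sum>n<Suc N. f (s + real n * \<sigma>))
        = integral {0..\<sigma>} (\<lambda>s. \<Sum>n<N. f (s + real n * \<sigma>))
          + integral {0..\<sigma>} (\<lambda>s. f (s + real N * \<sigma>))"
      unfolding sum.lessThan_Suc
      by (intro integral_add integrable_continuous_real continuous_on_sum cont)
    also have "integral {0..\<sigma>} (\<lambda>s. f (s + real N * \<sigma>))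
        = integral {real N * \<sigma>..real (Suc N) * \<sigma>} f"
    proof -
      \<comment> \<open>Shifting the interval by its own left endpoint makes it start at 0;
        \<open>*\<close> identifies the right endpoint.\<close>
      have *: "real (Suc N) * \<sigma> - real N * \<sigma> = \<sigma>" by (simp add: algebra_simps)
      show ?thesis
        using integral_shift_real_ivl[where f = f and a = "real N * \<sigma>" and c = "real N * \<sigma>"
            and b = "real (Suc N) * \<sigma>"] by (simp only: * diff_self)
    qed
    also note Suc.IH
    also have "integral {0..real N * \<sigma>} f + integral {real N * \<sigma>..real (Suc N) * \<sigma>} f
        = integral {0..real (Suc N) * \<sigma>} f"
      using assms(2)
      by (intro Henstock_Kurzweil_Integration.integral_combine integ) (auto simp: algebra_simps)
    finally show ?case .
  qed simp
qed

section \<open>Periodic cocycles: continuity, periodic trajectories and asymptotic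
  periodicity\<close>

locale circle_cocycle = cocycle "circle \<sigma>" setdist rotation \<psi>
  for \<sigma> :: real and \<psi> :: "real \<Rightarrow> real set \<Rightarrow> 'h::{real_inner, complete_space} \<Rightarrow> 'h" +
  assumes period_pos: "\<sigma> > 0"
begin

lemma rotation_add_period:
  assumes "q \<in> circle \<sigma>"
  shows "rotation (t + real n * \<sigma>) q = rotation t q"
proof -
  obtain x where q: "q = circle_coset \<sigma> x"
    using assms by (auto simp: circle_def)
  \<comment> \<open>Cosets with a common element coincide; this element has index 0 in the first
    coset and index \<open>n\<close> in the second.\<close>
  have "x + t + real n * \<sigma> \<in> rotation (t + real n * \<sigma>) q"
    unfolding q rotation_def circle_coset_def image_image by (rule image_eqI[of _ _ 0]) auto
  moreover have "x + t + real n * \<sigma> \<in> rotation t q"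
    unfolding q rotation_def circle_coset_def image_image by (rule image_eqI[of _ _ "int n"]) auto
  ultimately show ?thesis
    using circle_eqI rotation_in_circle assms by blast
qed

lemma psi_add_period:
  assumes "q \<in> circle \<sigma>" "0 \<le> t"
  shows "\<psi> (t + real n * \<sigma>) q u = \<psi> t q (\<psi> (real n * \<sigma>) q u)"
  using cocycle_add[OF assms, of "real n * \<sigma>" u] rotation_add_period[OF assms(1), of 0 n]
    flow_zero[OF assms(1)] period_pos by simp

text \<open>Freezing the base point turns continuity in product topologies into
  \<open>continuous_on\<close>.\<close>

lemma continuous_on_psi:
  assumes "q \<in> circle \<sigma>"
  shows "continuous_on ({0..} \<times> UNIV) (\<lambda>(t, u). \<psi> t q u)"
proof -
  let ?X = "top_of_set ({0..} \<times> UNIV :: (real \<times> 'h) set)"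
  have "continuous_map ?X (prod_topology (top_of_set {0..}) (prod_topology mtopology euclidean))
      (\<lambda>(t, u). (t, q, u))"
    unfolding case_prod_unfold
    by (intro continuous_map_pairedI)
      (auto simp: assms continuous_map_in_subtopology intro!: continuous_intros)
  from continuous_map_compose[OF this cocycle_continuous]
  have "continuous_map ?X euclidean (\<lambda>(t, u). \<psi> t q u)"
    by (simp add: o_def case_prod_unfold)
  then show ?thesis by simp
qed

lemma continuous_on_psi_comp [continuous_intros]:
  assumes "q \<in> circle \<sigma>" "continuous_on S f" "continuous_on S g" "\<And>x. x \<in> S \<Longrightarrow> 0 \<le> f x"
  shows "continuous_on S (\<lambda>x. \<psi> (f x) q (g x))"
  using continuous_on_compose2[OF continuous_on_psi[OF assms(1)], of S "\<lambda>x. (f x, g x)"] assms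
  by (auto intro!: continuous_on_Pair)

lemma tendsto_psi:
  assumes "q \<in> circle \<sigma>" "0 \<le> t" "X \<longlonglongrightarrow> x"
  shows "(\<lambda>n. \<psi> t q (X n)) \<longlonglongrightarrow> \<psi> t q x"
proof -
  have "continuous_on UNIV (\<lambda>u. \<psi> t q u)"
    by (intro continuous_intros assms(1)) (use assms in auto)
  then show ?thesis
    using assms(3) continuous_on_tendsto_compose by fastforce
qed

text \<open>A convergent sequence together with its limit is compact, so the cocycle is uniformly
  continuous on its product with a compact time interval.\<close>

lemma uniform_limit_psi:
  assumes q: "q \<in> circle \<sigma>" and X: "X \<longlonglongrightarrow> p"
  shows "uniform_limit {0..a} (\<lambda>n s. \<psi> s q (X n)) (\<lambda>s. \<psi> s q p) sequentially"
proof (rule uniform_limitI)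
  fix e :: real assume "e > 0"
  let ?K = "{0..a} \<times> insert p (range X)"
  have "compact ?K"
    using compactin_sequence_with_limit[of euclidean X p "range X"] X by (intro compact_Times) auto
  moreover have "continuous_on ?K (\<lambda>(t, u). \<psi> t q u)"
    by (rule continuous_on_subset[OF continuous_on_psi[OF q]]) auto
  ultimately have "uniformly_continuous_on ?K (\<lambda>(t, u). \<psi> t q u)"
    by (rule compact_uniformly_continuous[rotated])
  then obtain d where d: "d > 0"
      "\<And>x y. \<lbrakk>x \<in> ?K; y \<in> ?K; dist y x < d\<rbrakk> \<Longrightarrow>
        dist ((\<lambda>(t, u). \<psi> t q u) y) ((\<lambda>(t, u). \<psi> t q u) x) < e"
    using \<open>e > 0\<close> unfolding uniformly_continuous_on_def by meson
  have "\<forall>\<^sub>F n in sequentially. dist (X n) p < d"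
    using X d(1) by (simp add: tendsto_iff)
  then show "\<forall>\<^sub>F n in sequentially. \<forall>s\<in>{0..a}. dist (\<psi> s q (X n)) (\<psi> s q p) < e"
  proof eventually_elim
    case (elim n)
    then show ?case
      using d(2)[of "(_, p)" "(_, X n)"] by (auto simp: dist_Pair_Pair)
  qed
qed

text \<open>The forward orbit of a fixed point of the period map is periodic, so adding whole
  periods to a negative time extends it to the whole line.\<close>

lemma periodic_trajectory_of_fixed_point:
  assumes q: "q \<in> circle \<sigma>" and fixp: "\<psi> \<sigma> q p = p"
  obtains v where "periodic_trajectory \<sigma> \<psi> q v" "\<And>t. 0 \<le> t \<Longrightarrow> v t = \<psi> t q p"
proof -
  have fixn: "\<psi> (real n * \<sigma>) q p = p" for n
  proof (induction n)
    case 0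
    then show ?case using cocycle_zero[OF q] by simp
  next
    case (Suc n)
    then show ?case
      using psi_add_period[OF q, of \<sigma> n p] period_pos fixp by (simp add: algebra_simps)
  qed
  have per: "\<psi> (t + real n * \<sigma>) q p = \<psi> t q p" if "0 \<le> t" for t n
    using psi_add_period[OF q that, of n p] fixn by simp
  \<comment> \<open>The added periods make the time nonnegative; by \<open>v_eq\<close> below, any
    other number with this effect gives the same value.\<close>
  define v where "v t = \<psi> (t + real (nat \<lceil>\<bar>t\<bar> / \<sigma>\<rceil>) * \<sigma>) q p" for t
  have nonneg: "0 \<le> t + real (nat \<lceil>\<bar>t\<bar> / \<sigma>\<rceil>) * \<sigma>" for t
  proof -
    have "\<bar>t\<bar> / \<sigma> \<le> real (nat \<lceil>\<bar>t\<bar> / \<sigma>\<rceil>)" by linarith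
    then have "\<bar>t\<bar> \<le> real (nat \<lceil>\<bar>t\<bar> / \<sigma>\<rceil>) * \<sigma>"
      using period_pos by (simp only: pos_divide_le_eq)
    then show ?thesis by linarith
  qed
  \<comment> \<open>Both sides equal the value at the time obtained from \<open>t\<close> by adding
    both numbers of periods.\<close>
  have v_eq: "v t = \<psi> (t + real n * \<sigma>) q p" if "0 \<le> t + real n * \<sigma>" for t n
    using per[OF that, of "nat \<lceil>\<bar>t\<bar> / \<sigma>\<rceil>"] per[OF nonneg, of t n]
    unfolding v_def by (simp add: algebra_simps)
  have "v (t + s) = \<psi> t (rotation s q) (v s)" if "0 \<le> t" for t s
  proof -
    define n where "n = nat \<lceil>\<bar>s\<bar> / \<sigma>\<rceil>"
    have n: "0 \<le> s + real n * \<sigma>"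
      using nonneg n_def by simp
    have "v (t + s) = \<psi> (t + (s + real n * \<sigma>)) q p"
      using v_eq[of "t + s" n] n that by (simp add: add.assoc)
    also have "\<dots> = \<psi> t (rotation (s + real n * \<sigma>) q) (\<psi> (s + real n * \<sigma>) q p)"
      by (rule cocycle_add[OF q that n])
    finally show ?thesis
      using v_eq[OF n] rotation_add_period[OF q] by simp
  qed
  moreover have "continuous_on UNIV v"
  proof -
    have "isCont v t" for t
    proof -
      \<comment> \<open>The extra period puts \<open>t\<close> inside the open set
        \<open>?S\<close>, on which one formula represents \<open>v\<close>.\<close>
      define n where "n = Suc (nat \<lceil>\<bar>t\<bar> / \<sigma>\<rceil>)"
      let ?S = "{- (real n * \<sigma>)<..}"
      have "continuous_on ?S (\<lambda>t. \<psi> (t + real n * \<sigma>) q p)"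
        by (intro continuous_intros q) auto
      then have "continuous_on ?S v"
        by (rule continuous_on_eq) (use v_eq[of _ n] in auto)
      moreover have "t \<in> ?S"
        using nonneg[of t] period_pos by (simp add: n_def algebra_simps)
      ultimately show ?thesis
        by (simp add: continuous_on_eq_continuous_at)
    qed
    then show ?thesis by (simp add: continuous_at_imp_continuous_on)
  qed
  moreover have "v (t + \<sigma>) = v t" for t
  proof -
    \<comment> \<open>With one more period for \<open>t\<close> than for
      \<open>t + \<sigma>\<close>, both values are read off at the same time.\<close>
    have "0 \<le> t + real (Suc (nat \<lceil>\<bar>t\<bar> / \<sigma>\<rceil>)) * \<sigma>"
      using nonneg[of t] period_pos by (simp add: algebra_simps)
    from v_eq[OF this] v_eq[of "t + \<sigma>" "nat \<lceil>\<bar>t\<bar> / \<sigma>\<rceil>"] nonneg[of t] period_pos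
    show ?thesis by (simp add: algebra_simps)
  qed
  ultimately have "periodic_trajectory \<sigma> \<psi> q v"
    by (simp add: periodic_trajectory_def complete_trajectory_def)
  moreover have "v t = \<psi> t q p" if "0 \<le> t" for t
    using v_eq[of t 0] that by simp
  ultimately show ?thesis using that by blast
qed

text \<open>The limit is fixed by the period map, which shifts the sequence by one index. Uniform
  convergence over one period then passes from multiples of the period to all times.\<close>

lemma asymptotically_periodic:
  assumes q: "q \<in> circle \<sigma>" and conv: "convergent (\<lambda>n. \<psi> (real n * \<sigma>) q u)"
  shows "\<exists>v. periodic_trajectory \<sigma> \<psi> q v \<and> ((\<lambda>t. \<psi> t q u - v t) \<longlongrightarrow> 0) at_top"
proof -
  obtain p where p: "(\<lambda>n. \<psi> (real n * \<sigma>) q u) \<longlonglongrightarrow> p"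
    using conv by (auto simp: convergent_def)
  have "(\<lambda>n. \<psi> \<sigma> q (\<psi> (real n * \<sigma>) q u)) \<longlonglongrightarrow> \<psi> \<sigma> q p"
    using tendsto_psi[OF q _ p] period_pos by simp
  moreover have "\<psi> \<sigma> q (\<psi> (real n * \<sigma>) q u) = \<psi> (real (Suc n) * \<sigma>) q u" for n
    using psi_add_period[OF q, of \<sigma> n u] period_pos by (simp add: algebra_simps)
  ultimately have fixp: "\<psi> \<sigma> q p = p"
    using LIMSEQ_Suc[OF p] LIMSEQ_unique by simp
  obtain v where v: "periodic_trajectory \<sigma> \<psi> q v" "\<And>t. 0 \<le> t \<Longrightarrow> v t = \<psi> t q p"
    using periodic_trajectory_of_fixed_point[OF q fixp] by blast
  have v_add: "v (s + real n * \<sigma>) = v s" for s n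
  proof (induction n)
    case (Suc n)
    have "v (s + real n * \<sigma> + \<sigma>) = v (s + real n * \<sigma>)"
      using v(1) unfolding periodic_trajectory_def by blast
    then show ?case using Suc by (simp add: algebra_simps)
  qed simp
  have "((\<lambda>t. \<psi> t q u - v t) \<longlongrightarrow> 0) at_top"
  proof (rule tendstoI)
    fix e :: real assume "e > 0"
    then obtain N where N: "\<And>n s. \<lbrakk>n \<ge> N; s \<in> {0..\<sigma>}\<rbrakk> \<Longrightarrow>
        dist (\<psi> s q (\<psi> (real n * \<sigma>) q u)) (\<psi> s q p) < e"
      using uniform_limitD[OF uniform_limit_psi[OF q p, of \<sigma>] \<open>e > 0\<close>]
      unfolding eventually_sequentially by blast
    have "dist (\<psi> t q u - v t) 0 < e" if t: "t \<ge> real N * \<sigma>" for t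
    proof -
      define n s where "n = nat \<lfloor>t / \<sigma>\<rfloor>" and "s = t - real n * \<sigma>"
      have "0 \<le> t" using t period_pos by (meson mult_nonneg_nonneg of_nat_0_le_iff order_trans less_imp_le)
      have "real N \<le> t / \<sigma>" using t period_pos by (simp add: pos_le_divide_eq)
      then have "N \<le> n" unfolding n_def by linarith
      have "real n \<le> t / \<sigma>" "t / \<sigma> \<le> real n + 1"
        unfolding n_def using \<open>0 \<le> t\<close> period_pos by (auto simp: less_imp_le)
      then have s: "s \<in> {0..\<sigma>}"
        using period_pos unfolding s_def by (auto simp: field_simps)
      have ts: "t = s + real n * \<sigma>" by (simp add: s_def)
      have "v t = \<psi> s q p"
        unfolding ts v_add using v(2) s by simp
      moreover have "\<psi> t q u = \<psi> s q (\<psi> (real n * \<sigma>) q u)"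
        unfolding ts using psi_add_period[OF q] s by simp
      ultimately show ?thesis
        using N[OF \<open>N \<le> n\<close> s] by (simp add: dist_norm)
    qed
    then show "\<forall>\<^sub>F t in at_top. dist (\<psi> t q u - v t) 0 < e"
      by (metis (mono_tags, lifting) eventually_at_top_linorder)
  qed
  with v(1) show ?thesis by blast
qed

section \<open>Convergence at multiples of the period: the two cases\<close>

lemma convergent_if_weighted_integral_bounded:
  assumes q: "q \<in> circle \<sigma>" and "\<nu> > 0"
    and bound: "\<And>N. integral {0..real N * \<sigma>}
        (\<lambda>s. exp (2 * \<nu> * s) * (norm (\<psi> (s + \<sigma>) q u - \<psi> s q u))\<^sup>2) \<le> C"
  shows "convergent (\<lambda>n. \<psi> (real n * \<sigma>) q u)"
proof -
  define f where "f s = exp (2 * \<nu> * s) * (norm (\<psi> (s + \<sigma>) q u - \<psi> s q u))\<^sup>2" for s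
  \<comment> \<open>The average over phases is at most \<open>C / \<sigma>\<close>; adding 1 makes
    \<open>\<sigma> * D\<close> exceed \<open>C\<close>, so the sum cannot exceed \<open>D\<close>
    at every phase.\<close>
  define D where "D = C / \<sigma> + 1"
  define A where "A N = {s \<in> {0..\<sigma>}. (\<Sum>n<N. f (s + real n * \<sigma>)) \<le> D}" for N
  have f_cont: "continuous_on {0..} f"
    unfolding f_def by (intro continuous_intros q) (use period_pos in auto)
  have f_nonneg: "0 \<le> f s" for s
    by (simp add: f_def)
  have sum_cont: "continuous_on {0..\<sigma>} (\<lambda>s. \<Sum>n<N. f (s + real n * \<sigma>))" for N
    by (intro continuous_on_sum continuous_on_compose2[OF f_cont])
      (auto intro!: continuous_intros simp: less_imp_le[OF period_pos])
  have A_compact: "compact (A N)" for N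
  proof -
    have "closed (A N)"
      unfolding A_def by (rule continuous_on_closed_Collect_le) (auto intro: sum_cont continuous_intros)
    moreover have "A N = {0..\<sigma>} \<inter> A N" by (auto simp: A_def)
    ultimately show ?thesis by (metis compact_Icc compact_Int_closed)
  qed
  have A_nonempty: "A N \<noteq> {}" for N
  proof
    assume "A N = {}"
    then have "integral {0..\<sigma>} (\<lambda>s. D) \<le> integral {0..\<sigma>} (\<lambda>s. \<Sum>n<N. f (s + real n * \<sigma>))"
      by (intro integral_le integrable_continuous_real sum_cont) (fastforce simp: A_def)+
    also have "\<dots> \<le> C"
      using integral_shift_period_sum[OF f_cont, of \<sigma> N] bound[of N] period_pos by (simp add: f_def[abs_def])
    finally have "\<sigma> * D \<le> C" using period_pos by simp
    then show False
      using period_pos by (simp add: D_def distrib_left)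
  qed
  have A_mono: "A n \<subseteq> A m" if "m \<le> n" for m n
  proof -
    have "(\<Sum>k<m. f (s + real k * \<sigma>)) \<le> (\<Sum>k<n. f (s + real k * \<sigma>))" for s
      using that f_nonneg by (intro sum_mono2) auto
    then show ?thesis by (auto simp: A_def intro: order_trans)
  qed
  \<comment> \<open>Nested nonempty compact sets have a common point, a phase that is good for all
    \<open>N\<close> at once.\<close>
  have "\<Inter>(range A) \<noteq> {}"
    using compact_nest[of A] A_compact A_nonempty A_mono by blast
  then obtain s where s: "\<And>N. s \<in> A N" by blast
  then have s01: "0 \<le> s" "s \<le> \<sigma>" using A_def by auto
  define X where "X n = \<psi> (s + real n * \<sigma>) q u" for n
  define c where "c = exp (- (\<nu> * \<sigma>))"
  have c: "0 < c" "c < 1" using \<open>\<nu> > 0\<close> period_pos by (auto simp: c_def)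
  have dist_X: "dist (X n) (X (Suc n)) \<le> sqrt D * c ^ n" for n
  proof -
    have "f (s + real n * \<sigma>) \<le> (\<Sum>k<Suc n. f (s + real k * \<sigma>))"
      by (rule member_le_sum) (auto simp: f_nonneg)
    also have "\<dots> \<le> D" using s[of "Suc n"] by (simp add: A_def)
    finally have fD: "f (s + real n * \<sigma>) \<le> D" .
    have cn: "c ^ n = exp (- (\<nu> * (real n * \<sigma>)))"
      by (simp add: c_def exp_of_nat_mult[symmetric] algebra_simps)
    \<comment> \<open>The squared decay factor cancels the growth of the weight over
      \<open>n\<close> periods; the remaining factor is at least 1.\<close>
    have "(c ^ n)\<^sup>2 * exp (2 * \<nu> * (s + real n * \<sigma>)) = exp (2 * \<nu> * s)"
      by (simp add: cn power2_eq_square exp_add[symmetric] algebra_simps)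
    moreover have "1 \<le> exp (2 * \<nu> * s)" using \<open>\<nu> > 0\<close> s01 by simp
    ultimately have "(dist (X n) (X (Suc n)))\<^sup>2
        \<le> ((c ^ n)\<^sup>2 * exp (2 * \<nu> * (s + real n * \<sigma>))) * (dist (X n) (X (Suc n)))\<^sup>2"
      by (simp add: mult_le_cancel_right1)
    also have "\<dots> = (c ^ n)\<^sup>2 * f (s + real n * \<sigma>)"
      unfolding f_def X_def dist_norm by (simp add: norm_minus_commute algebra_simps)
    also have "\<dots> \<le> (c ^ n)\<^sup>2 * D" using fD by (simp add: mult_left_mono)
    finally have "(dist (X n) (X (Suc n)))\<^sup>2 \<le> (c ^ n)\<^sup>2 * D" .
    then have "dist (X n) (X (Suc n)) \<le> sqrt ((c ^ n)\<^sup>2 * D)"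
      by (rule real_le_rsqrt)
    then show ?thesis using c(1) by (simp add: real_sqrt_mult mult.commute)
  qed
  have "summable (\<lambda>n. sqrt D * c ^ n)"
    using c by (intro summable_mult summable_geometric) simp
  then have "summable (\<lambda>n. dist (X n) (X (Suc n)))"
    by (rule summable_comparison_test'[where N = 0]) (simp only: real_norm_def abs_of_nonneg zero_le_dist dist_X)
  then have "convergent X"
    using Cauchy_if_summable_dist Cauchy_convergent by blast
  then obtain L where L: "X \<longlonglongrightarrow> L" by (auto simp: convergent_def)
  \<comment> \<open>By periodicity the base point does not depend on \<open>n\<close>, so a single
    continuous map carries \<open>X n\<close> to the end of its period.\<close>
  have "\<psi> (real (Suc n) * \<sigma>) q u = \<psi> (\<sigma> - s) (rotation s q) (X n)" for n
  proof -
    have "\<psi> (real (Suc n) * \<sigma>) q u = \<psi> ((\<sigma> - s) + (s + real n * \<sigma>)) q u"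
      by (simp add: algebra_simps)
    also have "\<dots> = \<psi> (\<sigma> - s) (rotation (s + real n * \<sigma>) q) (X n)"
      unfolding X_def using s01 period_pos by (intro cocycle_add q) auto
    finally show ?thesis by (simp only: rotation_add_period[OF q])
  qed
  then have "convergent (\<lambda>n. \<psi> (real (Suc n) * \<sigma>) q u)"
    using tendsto_psi[OF rotation_in_circle[OF q, of s] _ L, of "\<sigma> - s"] s01
    by (simp add: convergentI del: of_nat_Suc)
  then show ?thesis
    by (rule convergent_Suc_iff[THEN iffD1])
qed

text \<open>For two limit points \<open>x\<close> and \<open>y\<close>, contraction yields
  \<open>V (x - y) \<le> 0\<close>, while convergence of the functional makes \<open>x - y\<close>
  orthogonal to \<open>e\<close>, where \<open>V\<close> is positive away from zero.\<close>

lemma convergent_if_functional_convergent: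
  fixes V :: "'h \<Rightarrow> real"
  assumes q: "q \<in> circle \<sigma>" and "\<nu> > 0"
    and K: "compact K" "\<And>n. \<psi> (real n * \<sigma>) q u \<in> K"
    and V: "continuous_on UNIV V"
    and contraction: "\<And>t a b. 0 \<le> t \<Longrightarrow> exp (2 * \<nu> * t) * V (\<psi> t q a - \<psi> t q b) \<le> V (a - b)"
    and pos: "\<And>z. \<lbrakk>z \<bullet> e = 0; z \<noteq> 0\<rbrakk> \<Longrightarrow> 0 < V z"
    and conv: "convergent (\<lambda>n. \<psi> (real n * \<sigma>) q u \<bullet> e)"
  shows "convergent (\<lambda>n. \<psi> (real n * \<sigma>) q u)"
proof (rule convergent_if_unique_subseq_limit[OF K])
  define X where "X n = \<psi> (real n * \<sigma>) q u" for n
  fix r r' :: "nat \<Rightarrow> nat" and x y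
  assume r: "strict_mono r" "strict_mono r'"
    and "((\<lambda>n. \<psi> (real n * \<sigma>) q u) \<circ> r) \<longlonglongrightarrow> x" "((\<lambda>n. \<psi> (real n * \<sigma>) q u) \<circ> r') \<longlonglongrightarrow> y"
  then have x: "(\<lambda>n. X (r n)) \<longlonglongrightarrow> x" and y: "(\<lambda>n. X (r' n)) \<longlonglongrightarrow> y"
    by (simp_all add: X_def o_def)
  have "compact ((\<lambda>(a, b). V (a - b)) ` (K \<times> K))"
    unfolding case_prod_unfold
    by (intro compact_continuous_image compact_Times K continuous_on_compose2[OF V] continuous_intros) auto
  then obtain M where M: "\<And>a b. \<lbrakk>a \<in> K; b \<in> K\<rbrakk> \<Longrightarrow> V (a - b) \<le> M"
    by (fastforce dest!: compact_imp_bounded simp: bounded_real abs_le_iff)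
  \<comment> \<open>Going back \<open>n\<close> periods in both indices leads to two points of
    \<open>K\<close>, where \<open>M\<close> bounds \<open>V\<close> of the difference.\<close>
  have XV: "V (X m - X m') \<le> exp (- (2 * \<nu> * (real n * \<sigma>))) * M" if "n \<le> m" "n \<le> m'" for n m m'
  proof -
    have X_add: "X m = \<psi> (real n * \<sigma>) q (X (m - n))" if "n \<le> m" for m
      using psi_add_period[OF q, of "real n * \<sigma>" "m - n" u] that period_pos
      by (simp add: X_def algebra_simps of_nat_diff)
    have "exp (2 * \<nu> * (real n * \<sigma>)) * V (X m - X m') \<le> V (X (m - n) - X (m' - n))"
      unfolding X_add[OF that(1)] X_add[OF that(2)] using period_pos by (intro contraction) simp
    also have "\<dots> \<le> M" using M K(2) X_def by simp
    finally show ?thesis by (simp add: exp_minus field_simps)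
  qed
  have "(\<lambda>n. V (X (r n) - X (r' n))) \<longlonglongrightarrow> V (x - y)"
    by (rule continuous_on_tendsto_compose[OF V]) (auto intro!: tendsto_diff x y)
  moreover have "(\<lambda>n. exp (- (2 * \<nu> * (real n * \<sigma>))) * M) \<longlonglongrightarrow> 0"
  proof -
    have "(\<lambda>n. exp (- (2 * \<nu> * \<sigma>)) ^ n * M) \<longlonglongrightarrow> 0 * M"
      using \<open>\<nu> > 0\<close> period_pos by (intro tendsto_mult LIMSEQ_power_zero tendsto_const) auto
    then show ?thesis by (simp add: exp_of_nat_mult[symmetric] algebra_simps)
  qed
  \<comment> \<open>A strictly increasing index satisfies \<open>n \<le> r n\<close>, so
    \<open>XV\<close> applies to the pair \<open>r n\<close>, \<open>r' n\<close>.\<close>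
  ultimately have "V (x - y) \<le> 0"
    by (rule LIMSEQ_le) (use XV r seq_suble in blast)
  moreover have "(x - y) \<bullet> e = 0"
  proof -
    obtain l where l: "(\<lambda>n. X n \<bullet> e) \<longlonglongrightarrow> l"
      using conv by (auto simp: convergent_def X_def)
    have "(\<lambda>n. X (r n) \<bullet> e) \<longlonglongrightarrow> x \<bullet> e" "(\<lambda>n. X (r' n) \<bullet> e) \<longlonglongrightarrow> y \<bullet> e"
      by (intro tendsto_intros x y)+
    moreover have "(\<lambda>n. X (r n) \<bullet> e) \<longlonglongrightarrow> l" "(\<lambda>n. X (r' n) \<bullet> e) \<longlonglongrightarrow> l"
      using LIMSEQ_subseq_LIMSEQ[OF l] r by (auto simp: o_def)
    ultimately show ?thesis
      using LIMSEQ_unique by (metis inner_diff_left cancel_comm_monoid_add_class.diff_cancel)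
  qed
  ultimately show "x = y" using pos[of "x - y"] by fastforce
qed

text \<open>A continuous function without zeros on a half-line has constant sign. The increments
  over one period therefore make the sampled functional eventually monotone, and it is
  bounded.\<close>

lemma convergent_functional_if_nonvanishing:
  assumes q: "q \<in> circle \<sigma>" and bdd: "bounded ((\<lambda>t. \<psi> t q u) ` {0..})" and "0 \<le> t\<^sub>0"
    and nonzero: "\<And>t. t\<^sub>0 \<le> t \<Longrightarrow> (\<psi> (t + \<sigma>) q u - \<psi> t q u) \<bullet> e \<noteq> 0"
  shows "convergent (\<lambda>n. \<psi> (real n * \<sigma>) q u \<bullet> e)"
proof -
  define g where "g t = (\<psi> (t + \<sigma>) q u - \<psi> t q u) \<bullet> e" for t
  have "continuous_on {t\<^sub>0..} g"
    unfolding g_def by (intro continuous_intros q) (use assms(3) period_pos in auto)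
  then have "connected (g ` {t\<^sub>0..})"
    by (intro connected_continuous_image) auto
  moreover have "0 \<notin> g ` {t\<^sub>0..}" using nonzero g_def by auto
  ultimately have sign: "(\<forall>t\<ge>t\<^sub>0. 0 \<le> g t) \<or> (\<forall>t\<ge>t\<^sub>0. g t \<le> 0)"
    using connectedD_interval[of "g ` {t\<^sub>0..}" _ _ 0] by (metis atLeast_iff imageI linear)
  \<comment> \<open>Discarding the first \<open>N\<close> samples leaves only times past
    \<open>t\<^sub>0\<close>.\<close>
  obtain N where N: "t\<^sub>0 < real N * \<sigma>"
    using reals_Archimedean3[OF period_pos] by blast
  define Y where "Y n = \<psi> (real (n + N) * \<sigma>) q u \<bullet> e" for n
  have late: "t\<^sub>0 \<le> real (n + N) * \<sigma>" for n
    using N mult_right_mono[of "real N" "real (n + N)" \<sigma>] period_pos by linarith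
  have Y_Suc: "Y (Suc n) - Y n = g (real (n + N) * \<sigma>)" for n
    by (simp add: Y_def g_def algebra_simps inner_diff_left)
  have "(\<forall>n. Y n \<le> Y (Suc n)) \<or> (\<forall>n. Y (Suc n) \<le> Y n)"
    using sign late Y_Suc by (metis diff_ge_0_iff_ge diff_le_0_iff_le)
  then have "monoseq Y" by (simp add: monoseq_Suc)
  moreover have "Bseq Y"
  proof -
    obtain B where B: "\<And>t. 0 \<le> t \<Longrightarrow> norm (\<psi> t q u) \<le> B"
      using bdd unfolding bounded_iff by auto
    have "norm (Y n) \<le> B * norm e" for n
    proof -
      have "norm (Y n) \<le> norm (\<psi> (real (n + N) * \<sigma>) q u) * norm e"
        unfolding Y_def real_norm_def by (rule Cauchy_Schwarz_ineq2)
      also have "\<dots> \<le> B * norm e"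
        using B period_pos by (intro mult_right_mono) auto
      finally show ?thesis .
    qed
    then show ?thesis by (rule BseqI')
  qed
  ultimately have "convergent Y" by (rule Bseq_monoseq_convergent[rotated])
  then show ?thesis
    unfolding Y_def by (subst (asm) convergent_ignore_initial_segment)
qed

end

section \<open>The negative line and the case distinction\<close>

lemma orthogonal_line_complement:
  assumes sum: "orthogonal_direct_sum A B" and dim: "dim B = 1"
  obtains e where "\<And>z. z \<bullet> e = 0 \<Longrightarrow> z \<in> A"
proof -
  have B: "subspace B" using sum by (simp add: orthogonal_direct_sum_def)
  obtain S where S: "S \<subseteq> B" "B \<subseteq> span S" "card S = 1"
    using basis_exists[of B] dim by metis
  then obtain e where e: "S = {e}" by (auto simp: card_1_singleton_iff)
  have "z \<in> A" if z: "z \<bullet> e = 0" for z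
  proof -
    obtain a b where ab: "a \<in> A" "b \<in> B" "z = a + b" "orthogonal a e"
      using sum S(1) unfolding e orthogonal_direct_sum_def by blast
    obtain c where "b = c *\<^sub>R e"
      using ab(2) S(2) unfolding e by (auto simp: span_singleton)
    moreover from this have "c *\<^sub>R e \<bullet> e = 0"
      using z ab by (simp add: orthogonal_def inner_add_left)
    \<comment> \<open>Either \<open>c\<close> or \<open>e\<close> is zero, and \<open>b\<close>
      vanishes in both cases.\<close>
    ultimately have "b = 0" by auto
    then show ?thesis using ab by simp
  qed
  then show ?thesis using that by blast
qed

theorem theorem2:
  fixes \<sigma> :: real
    and \<psi> :: "real \<Rightarrow> real set \<Rightarrow> 'h::{real_inner, complete_space} \<Rightarrow> 'h"
    and P :: "'h \<Rightarrow> 'h"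
    and H_plus H_minus :: "'h set"
    and V :: "'h \<Rightarrow> real"
    and \<delta> \<nu> :: real
  assumes "separable_space (euclidean :: 'h topology)"
    and "\<sigma> > 0"
    and "periodic_cocycle \<sigma> \<psi>"
    and "bounded_linear P"
    and "self_adjoint P"
    and "orthogonal_direct_sum H_plus H_minus"
    and "P ` H_plus \<subseteq> H_plus"
    and "P ` H_minus \<subseteq> H_minus"
    and "negative_on P H_minus"
    and "positive_on P H_plus"
    and "dim H_minus = 1"
    and "\<And>u. V u = P u \<bullet> u"
    and "\<delta> > 0"
    and "\<nu> > 0"
    and "\<And>u v q l r. \<lbrakk>q \<in> circle \<sigma>; 0 \<le> l; l \<le> r\<rbrakk> \<Longrightarrow>
           exp (2 * \<nu> * r) * V (\<psi> r q u - \<psi> r q v) - exp (2 * \<nu> * l) * V (\<psi> l q u - \<psi> l q v)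
             \<le> - \<delta> * integral {l..r} (\<lambda>s. exp (2 * \<nu> * s) * (norm (\<psi> s q u - \<psi> s q v))\<^sup>2)"
    and "\<And>q u. \<lbrakk>q \<in> circle \<sigma>; bounded_semi_trajectory (\<lambda>t. \<psi> t q u)\<rbrakk> \<Longrightarrow>
           compact_semi_trajectory (\<lambda>t. \<psi> t q u)"
  shows "\<forall>q\<in>circle \<sigma>. \<forall>u\<^sub>0. bounded_semi_trajectory (\<lambda>t. \<psi> t q u\<^sub>0) \<longrightarrow>
           (\<exists>u_star. periodic_trajectory \<sigma> \<psi> q u_star \<and>
              ((\<lambda>t. \<psi> t q u\<^sub>0 - u_star t) \<longlongrightarrow> 0) at_top)"
proof (intro ballI allI impI)
  fix q u\<^sub>0
  assume q: "q \<in> circle \<sigma>" and bdd: "bounded_semi_trajectory (\<lambda>t. \<psi> t q u\<^sub>0)"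
  interpret circle_cocycle \<sigma> \<psi>
    using assms(2,3) by (simp add: periodic_cocycle_def circle_cocycle_def circle_cocycle_axioms_def)
  obtain e where e: "\<And>z. z \<bullet> e = 0 \<Longrightarrow> z \<in> H_plus"
    using orthogonal_line_complement[OF assms(6) assms(11)] by blast
  have V_pos: "0 < V z" if "z \<bullet> e = 0" "z \<noteq> 0" for z
    using e[OF that(1)] that(2) assms(10,12) by (simp add: positive_on_def)
  have V_cont: "continuous_on UNIV V"
  proof -
    have "continuous_on UNIV (\<lambda>u. P u \<bullet> u)"
      by (intro continuous_intros linear_continuous_on assms(4))
    then show ?thesis using assms(12) by presburger
  qed
  \<comment> \<open>If the integrand is not integrable, the integral has the default value
    0.\<close>
  have weight_nonneg: "0 \<le> integral {l..r} (\<lambda>s. exp (2 * \<nu> * s) * (norm (\<psi> s q a - \<psi> s q b))\<^sup>2)" for l r a b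
    by (cases "(\<lambda>s. exp (2 * \<nu> * s) * (norm (\<psi> s q a - \<psi> s q b))\<^sup>2) integrable_on {l..r}")
      (auto intro: integral_nonneg simp: not_integrable_integral)
  have decreasing: "exp (2 * \<nu> * r) * V (\<psi> r q a - \<psi> r q b) \<le> exp (2 * \<nu> * l) * V (\<psi> l q a - \<psi> l q b)"
    if "0 \<le> l" "l \<le> r" for l r a b
    using assms(15)[OF q that, of a b] mult_nonneg_nonneg[OF less_imp_le[OF assms(13)] weight_nonneg[of l r a b]]
    by simp
  \<comment> \<open>Periodicity turns the increment over one period into a difference of two
    semi-trajectories at the same \<open>q\<close>, to which the inequality for \<open>V\<close>
    applies.\<close>
  have shift: "\<psi> (t + \<sigma>) q u\<^sub>0 = \<psi> t q (\<psi> \<sigma> q u\<^sub>0)" if "0 \<le> t" for t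
    using psi_add_period[OF q that, of 1 u\<^sub>0] by simp
  have "convergent (\<lambda>n. \<psi> (real n * \<sigma>) q u\<^sub>0)"
  proof (cases "\<forall>t\<ge>0. 0 \<le> V (\<psi> (t + \<sigma>) q u\<^sub>0 - \<psi> t q u\<^sub>0)")
    case True
    show ?thesis
    proof (rule convergent_if_weighted_integral_bounded[OF q assms(14)])
      fix N :: nat
      let ?T = "real N * \<sigma>"
      let ?f = "\<lambda>s. exp (2 * \<nu> * s) * (norm (\<psi> s q (\<psi> \<sigma> q u\<^sub>0) - \<psi> s q u\<^sub>0))\<^sup>2"
      have T: "0 \<le> ?T" using assms(2) by simp
      have "0 \<le> exp (2 * \<nu> * ?T) * V (\<psi> ?T q (\<psi> \<sigma> q u\<^sub>0) - \<psi> ?T q u\<^sub>0)"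
        using True shift T by (metis exp_ge_zero mult_nonneg_nonneg)
      then have "\<delta> * integral {0..?T} ?f \<le> V (\<psi> \<sigma> q u\<^sub>0 - u\<^sub>0)"
        using assms(15)[OF q _ T, of "\<psi> \<sigma> q u\<^sub>0" u\<^sub>0] cocycle_zero[OF q] by simp
      then have "integral {0..?T} ?f \<le> V (\<psi> \<sigma> q u\<^sub>0 - u\<^sub>0) / \<delta>"
        using assms(13) by (simp add: pos_le_divide_eq mult.commute)
      moreover have "integral {0..?T} (\<lambda>s. exp (2 * \<nu> * s) * (norm (\<psi> (s + \<sigma>) q u\<^sub>0 - \<psi> s q u\<^sub>0))\<^sup>2)
          = integral {0..?T} ?f"
        by (rule integral_cong) (simp add: shift)
      ultimately show "integral {0..?T} (\<lambda>s. exp (2 * \<nu> * s) * (norm (\<psi> (s + \<sigma>) q u\<^sub>0 - \<psi> s q u\<^sub>0))\<^sup>2)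
          \<le> V (\<psi> \<sigma> q u\<^sub>0 - u\<^sub>0) / \<delta>"
        by simp
    qed
  next
    case False
    then obtain t\<^sub>0 where t0: "0 \<le> t\<^sub>0" "V (\<psi> (t\<^sub>0 + \<sigma>) q u\<^sub>0 - \<psi> t\<^sub>0 q u\<^sub>0) < 0"
      by (auto simp: not_le)
    \<comment> \<open>Monotonicity keeps \<open>V\<close> of the increment negative after
      \<open>t\<^sub>0\<close>, whereas \<open>V\<close> is nonnegative on vectors orthogonal to
      \<open>e\<close>.\<close>
    have "(\<psi> (t + \<sigma>) q u\<^sub>0 - \<psi> t q u\<^sub>0) \<bullet> e \<noteq> 0" if t: "t\<^sub>0 \<le> t" for t
    proof -
      have "exp (2 * \<nu> * t) * V (\<psi> (t + \<sigma>) q u\<^sub>0 - \<psi> t q u\<^sub>0)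
          \<le> exp (2 * \<nu> * t\<^sub>0) * V (\<psi> (t\<^sub>0 + \<sigma>) q u\<^sub>0 - \<psi> t\<^sub>0 q u\<^sub>0)"
        using decreasing[OF t0(1) t, of "\<psi> \<sigma> q u\<^sub>0" u\<^sub>0] shift t0(1) t by simp
      also have "\<dots> < 0" using t0(2) by (simp add: mult_pos_neg)
      finally have "V (\<psi> (t + \<sigma>) q u\<^sub>0 - \<psi> t q u\<^sub>0) < 0"
        by (simp add: mult_less_0_iff)
      moreover have "V 0 = 0" using assms(12) by simp
      ultimately show ?thesis using V_pos by (metis less_asym less_irrefl)
    qed
    then have functional: "convergent (\<lambda>n. \<psi> (real n * \<sigma>) q u\<^sub>0 \<bullet> e)"
      using bdd t0(1) q
      by (intro convergent_functional_if_nonvanishing) (auto simp: bounded_semi_trajectory_def)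
    let ?K = "closure ((\<lambda>t. \<psi> t q u\<^sub>0) ` {0..})"
    have "compact ?K"
      using assms(16)[OF q bdd] by (simp add: compact_semi_trajectory_def)
    moreover have "\<psi> (real n * \<sigma>) q u\<^sub>0 \<in> ?K" for n
      using assms(2) by (intro closure_subset[THEN subsetD] imageI) simp
    moreover have "exp (2 * \<nu> * t) * V (\<psi> t q a - \<psi> t q b) \<le> V (a - b)" if "0 \<le> t" for t a b
      using decreasing[OF order_refl that, of a b] cocycle_zero[OF q] by simp
    ultimately show ?thesis
      using convergent_if_functional_convergent[OF q assms(14) _ _ V_cont _ V_pos functional] by blast
  qed
  then show "\<exists>u_star. periodic_trajectory \<sigma> \<psi> q u_star \<and> ((\<lambda>t. \<psi> t q u\<^sub>0 - u_star t) \<longlongrightarrow> 0) at_top"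
    by (rule asymptotically_periodic[OF q])
qed

end
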